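(* Let $b_i=1$ for all $i\in\mathcal{V}$. Consider an undirected star graph on $\mathcal{V}=\{1,\dots,N\}$ with the weights $w_{ij}=1$, $i\ne j$, $i,j\in\mathcal{V}$. Without loss of generality, suppose that node $1$ is the center node. The equilibria of the system $x(k+1)=F(x(k))$ include those vectors whose elements are either zero or one, and $x^\ast=[\frac12,a_2,\dots,a_N]^\top$ with $a_i\in[0,1]$ and $\sum_{i=2}^N a_i=\frac{N-1}{2}$. If $N$ is odd, the system has additional equilibria of the form $x^\ast=[c,\mathbf{0}_{\frac{N-1}{2}}^\top,\mathbf{1}_{\frac{N-1}{2}}^\top]^\top$ with $c\in(0,1)$. Among these equilibria, $x_a^\ast=\mathbf{0}_N$ and $x_c^\ast=\mathbf{1}_N$ are locally exponentially stable and all the other equilibria are unstable.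
   Context: There are $N$ agents, $\mathcal{V}=\{1,\dots,N\}$. $\mathbb{G}=(\mathcal{V},\mathcal{E})$ is the neighbor graph, without self-loops, and $\mathcal{N}_i=\{j\in\mathcal{V}:(j,i)\in\mathcal{E}\}$ is the set of neighbors of agent $i$; for the star graph with center $1$, $\mathcal{N}_1=\{2,\dots,N\}$ and $\mathcal{N}_i=\{1\}$ for $i\ge 2$. The weight matrix $W=(w_{ij})_{N\times N}$ has self-weights $w_{ii}\ge 0$; only the weights $w_{ij}$ with $j\in\mathcal{N}_i$ or $j=i$ enter the dynamics. Each agent $i$ has a real bias parameter $b_i$. Put $d_i=\sum_{j\in\mathcal{N}_i}w_{ij}$ and, for $x=(x_1,\dots,x_N)^\top$, $s_i=\sum_{j\in\mathcal{N}_i}w_{ij}x_j$ and $$f_i(x)=\frac{w_{ii}x_i+x_i^{b_i}s_i}{w_{ii}+x_i^{b_i}s_i+(1-x_i)^{b_i}(d_i-s_i)},\qquad F(x)=[f_1(x),\dots,f_N(x)]^\top.$$ The opinion dynamics is $x(k+1)=F(x(k))$, $k=0,1,2,\dots$, with $x_i(0)\in[0,1]$ for all $i$. $\mathbf{0}_n$ and $\mathbf{1}_n$ are the $n$-dimensional all-zero and all-one vectors. Local exponential stability and instability are in the usual sense for equilibria of discrete-time systems.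
   Formalization: The claims on 0/1 vectors are made only where F is defined: if some self-weight is 0, f_i can be 0/0 (e.g. w_11=0, x=[1,0,...,0]), so such vectors are not equilibria. N is at least 2, since for N=1 the stability claim fails. *)

theory Defs
  imports "HOL-Analysis.Analysis"
begin

section \<open>Opinion dynamics with biased assimilation\<close>

text \<open>
  Agents are the elements of a finite type, so the number of agents is \<open>CARD('n)\<close>.
  A pair \<open>(j, i) \<in> E\<close> means that \<open>j\<close> is a neighbor of \<open>i\<close>.
\<close>

definition neighbors :: "('n \<times> 'n) set \<Rightarrow> 'n \<Rightarrow> 'n set" where
  "neighbors E i = {j. (j, i) \<in> E}"

definition nbr_degree :: "('n::finite \<times> 'n) set \<Rightarrow> real^'n^'n \<Rightarrow> 'n \<Rightarrow> real" where
  "nbr_degree E w i = (\<Sum>j\<in>neighbors E i. w $ i $ j)"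

definition nbr_sum :: "('n::finite \<times> 'n) set \<Rightarrow> real^'n^'n \<Rightarrow> real^'n \<Rightarrow> 'n \<Rightarrow> real" where
  "nbr_sum E w x i = (\<Sum>j\<in>neighbors E i. w $ i $ j * x $ j)"

text \<open>
  Numerator and denominator of $f_i$. Real powers are \<open>powr\<close>; note that \<open>0 powr 0 = 0\<close>,
  so a zero bias at an opinion in $\{0,1\}$ does not follow the convention $0^0 = 1$.
\<close>

definition op_num ::
  "('n::finite \<times> 'n) set \<Rightarrow> real^'n^'n \<Rightarrow> real^'n \<Rightarrow> real^'n \<Rightarrow> 'n \<Rightarrow> real" where
  "op_num E w b x i = w $ i $ i * x $ i + (x $ i) powr (b $ i) * nbr_sum E w x i"

definition op_den ::
  "('n::finite \<times> 'n) set \<Rightarrow> real^'n^'n \<Rightarrow> real^'n \<Rightarrow> real^'n \<Rightarrow> 'n \<Rightarrow> real" where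
  "op_den E w b x i =
     w $ i $ i + (x $ i) powr (b $ i) * nbr_sum E w x i
       + (1 - x $ i) powr (b $ i) * (nbr_degree E w i - nbr_sum E w x i)"

definition op_map ::
  "('n::finite \<times> 'n) set \<Rightarrow> real^'n^'n \<Rightarrow> real^'n \<Rightarrow> real^'n \<Rightarrow> real^'n" where
  "op_map E w b x = (\<chi> i. op_num E w b x i / op_den E w b x i)"

text \<open>
  Self-weights may vanish, and then some $f_i$ can be the undefined expression $0/0$ at boundary
  points of the cube (an agent at $1$ whose neighbors are all at $0$, or vice
  versa). Since \<open>0 / 0 = 0\<close> in HOL, the domain of $F$ is recorded explicitly; equilibria and
  solutions below never leave it.
\<close>

definition op_defined ::
  "('n::finite \<times> 'n) set \<Rightarrow> real^'n^'n \<Rightarrow> real^'n \<Rightarrow> real^'n \<Rightarrow> bool" where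
  "op_defined E w b x \<longleftrightarrow> (\<forall>i. op_den E w b x i \<noteq> 0)"

definition opinions :: "(real^'n) set" where
  "opinions = {x. \<forall>i. 0 \<le> x $ i \<and> x $ i \<le> 1}"

definition op_solution ::
  "('n::finite \<times> 'n) set \<Rightarrow> real^'n^'n \<Rightarrow> real^'n \<Rightarrow> (nat \<Rightarrow> real^'n) \<Rightarrow> bool" where
  "op_solution E w b x \<longleftrightarrow>
     x 0 \<in> opinions \<and> (\<forall>k. op_defined E w b (x k) \<and> x (Suc k) = op_map E w b (x k))"

definition op_equilibrium ::
  "('n::finite \<times> 'n) set \<Rightarrow> real^'n^'n \<Rightarrow> real^'n \<Rightarrow> real^'n \<Rightarrow> bool" where
  "op_equilibrium E w b p \<longleftrightarrow> p \<in> opinions \<and> op_defined E w b p \<and> op_map E w b p = p"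

subsection \<open>Stability relative to the state space $[0,1]^N$\<close>

definition op_stable ::
  "('n::finite \<times> 'n) set \<Rightarrow> real^'n^'n \<Rightarrow> real^'n \<Rightarrow> real^'n \<Rightarrow> bool" where
  "op_stable E w b p \<longleftrightarrow>
     (\<forall>\<epsilon>>0. \<exists>\<delta>>0. \<forall>x. op_solution E w b x \<and> dist (x 0) p < \<delta> \<longrightarrow> (\<forall>k. dist (x k) p < \<epsilon>))"

definition op_unstable ::
  "('n::finite \<times> 'n) set \<Rightarrow> real^'n^'n \<Rightarrow> real^'n \<Rightarrow> real^'n \<Rightarrow> bool" where
  "op_unstable E w b p \<longleftrightarrow> op_equilibrium E w b p \<and> \<not> op_stable E w b p"

text \<open>
  Exponential stability also demands that a (necessarily unique) solution exists from every
  initial opinion vector close to the equilibrium.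
\<close>

definition op_exp_stable ::
  "('n::finite \<times> 'n) set \<Rightarrow> real^'n^'n \<Rightarrow> real^'n \<Rightarrow> real^'n \<Rightarrow> bool" where
  "op_exp_stable E w b p \<longleftrightarrow>
     op_equilibrium E w b p \<and>
     (\<exists>\<delta>>0. \<exists>M>0. \<exists>\<rho>. 0 < \<rho> \<and> \<rho> < 1 \<and>
        (\<forall>x0\<in>opinions. dist x0 p < \<delta> \<longrightarrow>
           (\<exists>x. op_solution E w b x \<and> x 0 = x0 \<and>
                (\<forall>k. dist (x k) p \<le> M * \<rho> ^ k * dist x0 p))))"

subsection \<open>The star graph and the listed equilibria\<close>

definition star_edges :: "'n \<Rightarrow> ('n \<times> 'n) set" where
  "star_edges v = {(j, i). j \<noteq> i \<and> (j = v \<or> i = v)}"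

definition binary_states :: "(real^'n) set" where
  "binary_states = {x. \<forall>i. x $ i = 0 \<or> x $ i = 1}"

text \<open>The vectors $[1/2, a_2, \dots, a_N]$, where \<open>v\<close> is the center.\<close>

definition half_states :: "'n::finite \<Rightarrow> (real^'n) set" where
  "half_states v =
     {x. x $ v = 1/2 \<and> (\<forall>i. i \<noteq> v \<longrightarrow> 0 \<le> x $ i \<and> x $ i \<le> 1) \<and>
         (\<Sum>i\<in>UNIV - {v}. x $ i) = (real CARD('n) - 1) / 2}"

text \<open>
  The vectors $[c, \mathbf{0}, \mathbf{1}]$: the leaves carry no preferred order, so the block of
  zeros sits on an arbitrary set \<open>Z\<close> of leaves. Meaningful for an odd number of agents only.
\<close>

definition split_states :: "'n::finite \<Rightarrow> (real^'n) set" where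
  "split_states v =
     {x. 0 < x $ v \<and> x $ v < 1 \<and>
         (\<exists>Z. v \<notin> Z \<and> card Z = (CARD('n) - 1) div 2 \<and>
              (\<forall>i. i \<noteq> v \<longrightarrow> x $ i = (if i \<in> Z then 0 else 1)))}"

subsection \<open>Basic facts\<close>

lemma neighbors_star:
  "neighbors (star_edges v) i = (if i = v then UNIV - {v} else {v})"
  by (auto simp: neighbors_def star_edges_def)

text \<open>With positive self-weights the map is defined on the whole cube.\<close>

lemma op_defined_if_self_weights_pos:
  assumes "\<And>i j. 0 \<le> w $ i $ j" and "\<And>i. 0 < w $ i $ i" and "x \<in> opinions"
  shows "op_defined E w b x"
  unfolding op_defined_def
proof
  fix i
  have x: "0 \<le> x $ j" "x $ j \<le> 1" for j
    using assms(3) by (auto simp: opinions_def)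
  have "0 \<le> nbr_sum E w x i"
    unfolding nbr_sum_def by (intro sum_nonneg mult_nonneg_nonneg assms x)
  moreover have "nbr_sum E w x i \<le> nbr_degree E w i"
    unfolding nbr_sum_def nbr_degree_def
    by (intro sum_mono mult_left_le assms x)
  ultimately have "0 < op_den E w b x i"
    unfolding op_den_def using assms(2)[of i] by (intro add_pos_nonneg) auto
  then show "op_den E w b x i \<noteq> 0" by simp
qed

end

theory Submission
  imports Defs
begin

text \<open>
  With all biases equal to one the dynamics can be written as
  \[ f_i(x) - x_i = \frac{x_i (1 - x_i) (2 s_i - d_i)}{D_i(x)}, \]
  where $D_i$ is the denominator of $f_i$: an agent moves towards the opinion that the weighted
  majority of its neighbors leans to. This identity carries almost everything.

  A state of the cube at which $F$ is defined is an equilibrium iff every agent sits at an end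
  point or sees a balanced neighborhood, $2 s_i = d_i$; all listed vectors are of this kind.

  The map $F$ commutes with the reflection $x \mapsto \mathbf{1} - x$, so each stability question
  needs to be settled for one of two mirror images only. On the small cube $[0, 1/8]^N$ every
  coordinate is contracted by a factor smaller than one, which makes $\mathbf{0}$, and by
  reflection $\mathbf{1}$, exponentially stable.

  Instability is shown without linearization. All solutions that start in the open cube stay in
  it, and some of them start arbitrarily close to any given equilibrium; it remains to find one
  coordinate that moves in one direction by at least a fixed positive amount per step as long as
  the solution stays near the equilibrium. There are two mechanisms.

  \<^item> An agent at $1$ whose neighbors lean strictly to $0$ (or vice versa) is repelled from its
    end point (lemma \<open>unstable_if_one_against_neighbors\<close>). Every binary equilibrium other than
    consensus on the star has a leaf in disagreement with the center.

  \<^item> In the half states and the split states the center has an opinion strictly between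
    $0$ and $1$, and the leaves are balanced. If the center is above $1/2$ and the leaves
    lean towards $1$, then the center and all leaves move up, so both facts persist and the drift
    of the center is bounded away from $0$ (lemma \<open>unstable_if_balanced_hub\<close>). Leaves close to
    $0$ or $1$ hardly react, but it is enough that they do not move down, so leaves in $\{0, 1\}$
    need no separate treatment.
\<close>

section \<open>Reflection of the cube\<close>

definition mirror :: "real^'n \<Rightarrow> real^'n::finite" where
  "mirror x = (\<chi> i. 1 - x $ i)"

lemma mirror_nth [simp]: "mirror x $ i = 1 - x $ i"
  by (simp add: mirror_def)

lemma mirror_mirror [simp]: "mirror (mirror x) = x"
  by (simp add: vec_eq_iff)

lemma mirror_opinions [simp]: "mirror x \<in> opinions \<longleftrightarrow> x \<in> opinions"
  by (auto simp: opinions_def)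

lemma dist_mirror [simp]: "dist (mirror x) (mirror y) = dist x y"
proof -
  have "mirror x - mirror y = - (x - y)"
    by (simp add: vec_eq_iff)
  then show ?thesis
    by (metis dist_norm norm_minus_cancel)
qed

section \<open>Dynamics with unit biases\<close>

definition open_cube :: "(real^'n) set" where
  "open_cube = {x. \<forall>i. 0 < x $ i \<and> x $ i < 1}"

lemma open_cube_opinions: "x \<in> open_cube \<Longrightarrow> x \<in> opinions"
  by (auto simp: open_cube_def opinions_def intro: less_imp_le)

lemma convex_comb_open_cube:
  assumes "p \<in> opinions" "q \<in> open_cube" "0 < t" "t < 1"
  shows "(1 - t) *\<^sub>R p + t *\<^sub>R q \<in> open_cube"
proof -
  have "0 < (1 - t) * p $ i + t * q $ i \<and> (1 - t) * p $ i + t * q $ i < 1" for i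
  proof
    have b: "0 \<le> p $ i" "p $ i \<le> 1" "0 < q $ i" "q $ i < 1"
      using assms by (auto simp: opinions_def open_cube_def)
    show "0 < (1 - t) * p $ i + t * q $ i"
      using b assms by (intro add_nonneg_pos) auto
    have "(1 - t) * p $ i \<le> (1 - t) * 1" "t * q $ i < t * 1"
      using b assms by (intro mult_left_mono mult_strict_left_mono; simp)+
    then show "(1 - t) * p $ i + t * q $ i < 1"
      by simp
  qed
  then show ?thesis
    by (simp add: open_cube_def)
qed

lemma no_bounded_steady_growth:
  fixes u :: "nat \<Rightarrow> real"
  assumes "0 < g" and "\<And>k. u k + g \<le> u (Suc k)" and "\<And>k. u k \<le> B"
  shows False
proof -
  have "u 0 + real k * g \<le> u k" for k
  proof (induction k)
    case (Suc k)
    then show ?case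
      using assms(2)[of k] by (simp add: algebra_simps)
  qed simp
  moreover obtain k where "B - u 0 < real k * g"
    using reals_Archimedean3[OF assms(1)] by blast
  ultimately show False
    using assms(3)[of k] by (smt (verit))
qed

locale unit_bias =
  fixes E :: "('n::finite \<times> 'n) set" and w :: "real^'n^'n" and b :: "real^'n"
  assumes bias: "b $ i = 1"
    and weight_nonneg: "0 \<le> w $ i $ j"
    and degree_pos: "0 < nbr_degree E w i"
begin

abbreviation "F \<equiv> op_map E w b"
abbreviation "den \<equiv> op_den E w b"
abbreviation "s \<equiv> nbr_sum E w"
abbreviation "d \<equiv> nbr_degree E w"

lemma num_eq: "x \<in> opinions \<Longrightarrow> op_num E w b x i = x $ i * (w $ i $ i + s x i)"
  by (simp add: op_num_def bias opinions_def algebra_simps)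

lemma den_eq: "x \<in> opinions \<Longrightarrow>
    den x i = w $ i $ i + x $ i * s x i + (1 - x $ i) * (d i - s x i)"
  by (simp add: op_den_def bias opinions_def)

text \<open>Both summands are visibly nonnegative, and the first one is the numerator.\<close>

lemma den_split: "x \<in> opinions \<Longrightarrow>
    den x i = x $ i * (w $ i $ i + s x i) + (1 - x $ i) * (w $ i $ i + (d i - s x i))"
  by (simp add: den_eq algebra_simps)

lemma F_nth: "x \<in> opinions \<Longrightarrow> F x $ i = x $ i * (w $ i $ i + s x i) / den x i"
  by (simp add: op_map_def num_eq)

lemma s_mirror: "s (mirror x) i = d i - s x i"
  by (simp add: nbr_sum_def nbr_degree_def algebra_simps sum_subtractf)

lemma s_nonneg: "x \<in> opinions \<Longrightarrow> 0 \<le> s x i"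
  unfolding nbr_sum_def
  by (intro sum_nonneg mult_nonneg_nonneg weight_nonneg) (auto simp: opinions_def)

lemma s_le_degree: "x \<in> opinions \<Longrightarrow> s x i \<le> d i"
  using s_nonneg[of "mirror x" i] by (simp add: s_mirror)

lemma s_pos:
  assumes "x \<in> open_cube"
  shows "0 < s x i"
proof (rule ccontr)
  assume "\<not> 0 < s x i"
  then have "s x i = 0"
    using s_nonneg[OF open_cube_opinions[OF assms], of i] by simp
  moreover have "\<forall>j\<in>neighbors E i. 0 \<le> w $ i $ j * x $ j"
    using assms weight_nonneg by (auto simp: open_cube_def less_imp_le)
  ultimately have "\<forall>j\<in>neighbors E i. w $ i $ j * x $ j = 0"
    unfolding nbr_sum_def by (subst (asm) sum_nonneg_eq_0_iff) auto
  then have "\<forall>j\<in>neighbors E i. w $ i $ j = 0"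
    using assms unfolding open_cube_def by (metis (mono_tags, lifting) less_irrefl mem_Collect_eq mult_eq_0_iff)
  then show False
    using degree_pos[of i] by (simp add: nbr_degree_def)
qed

lemma s_less_degree: "x \<in> open_cube \<Longrightarrow> s x i < d i"
  using s_pos[of "mirror x" i] by (simp add: s_mirror open_cube_def)

lemma den_pos:
  assumes "x \<in> opinions" "0 < s x i" "s x i < d i"
  shows "0 < den x i"
proof (cases "x $ i = 0")
  case True
  then show ?thesis
    using assms weight_nonneg[of i i] by (simp add: den_split)
next
  case False
  have x: "0 \<le> x $ i" "x $ i \<le> 1"
    using assms(1) by (auto simp: opinions_def)
  show ?thesis
    unfolding den_split[OF assms(1)]
    using assms x False weight_nonneg[of i i] by (intro add_pos_nonneg) auto
qed

lemma den_le:
  assumes "x \<in> opinions"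
  shows "den x i \<le> w $ i $ i + d i"
proof -
  have x: "0 \<le> x $ i" "x $ i \<le> 1"
    using assms by (auto simp: opinions_def)
  have "x $ i * s x i \<le> s x i" "(1 - x $ i) * (d i - s x i) \<le> d i - s x i"
    using x s_nonneg[OF assms, of i] s_le_degree[OF assms, of i]
    by (auto intro: mult_left_le_one_le)
  then show ?thesis
    by (simp add: den_eq[OF assms])
qed

lemma den_mirror: "x \<in> opinions \<Longrightarrow> den (mirror x) i = den x i"
  by (simp add: den_eq s_mirror)

text \<open>
  The form of the dynamics on which the whole analysis rests: the sign of the move of an agent
  strictly between the extremes is the sign of $2 s_i - d_i$.
\<close>

lemma increment:
  assumes "x \<in> opinions" "den x i \<noteq> 0"
  shows "F x $ i - x $ i = x $ i * (1 - x $ i) * (2 * s x i - d i) / den x i"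
proof -
  have "F x $ i - x $ i = (x $ i * (w $ i $ i + s x i) - x $ i * den x i) / den x i"
    using assms by (simp add: F_nth diff_divide_distrib)
  also have "x $ i * (w $ i $ i + s x i) - x $ i * den x i
      = x $ i * (1 - x $ i) * (2 * s x i - d i)"
    using assms(1) by (simp add: den_eq algebra_simps)
  finally show ?thesis .
qed

lemma equilibriumI:
  assumes "p \<in> opinions" "op_defined E w b p"
    and "\<And>i. p $ i = 0 \<or> p $ i = 1 \<or> 2 * s p i = d i"
  shows "op_equilibrium E w b p"
proof -
  have "F p $ i - p $ i = 0" for i
    using increment[OF assms(1), of i] assms(2,3) by (auto simp: op_defined_def)
  then show ?thesis
    using assms by (simp add: op_equilibrium_def vec_eq_iff)
qed

lemma F_mirror:
  assumes "x \<in> opinions" "op_defined E w b x"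
  shows "F (mirror x) = mirror (F x)"
proof -
  have opposite: "F (mirror x) $ i - mirror x $ i = - (F x $ i - x $ i)" for i
  proof -
    have "den x i \<noteq> 0"
      using assms(2) by (simp add: op_defined_def)
    moreover have "(1 - x $ i) * (1 - (1 - x $ i)) * (2 * (d i - s x i) - d i)
        = - (x $ i * (1 - x $ i) * (2 * s x i - d i))"
      by (simp add: algebra_simps)
    ultimately show ?thesis
      using assms(1) increment[of x i] increment[of "mirror x" i]
      by (simp add: den_mirror s_mirror)
  qed
  have "F (mirror x) $ i = mirror (F x) $ i" for i
    using opposite[of i] unfolding mirror_nth by linarith
  then show ?thesis
    unfolding vec_eq_iff by blast
qed

lemma defined_mirror: "x \<in> opinions \<Longrightarrow> op_defined E w b (mirror x) \<longleftrightarrow> op_defined E w b x"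
  by (simp add: op_defined_def den_mirror)

lemma F_opinions:
  assumes "x \<in> opinions"
  shows "F x \<in> opinions"
proof -
  have "0 \<le> F x $ i \<and> F x $ i \<le> 1" for i
  proof -
    let ?A = "x $ i * (w $ i $ i + s x i)" and ?B = "(1 - x $ i) * (w $ i $ i + (d i - s x i))"
    have "0 \<le> ?A" "0 \<le> ?B"
      using assms s_nonneg[OF assms, of i] s_le_degree[OF assms, of i] weight_nonneg[of i i]
      by (auto simp: opinions_def)
    then show ?thesis
      using assms by (simp add: F_nth den_split divide_le_eq_1) linarith
  qed
  then show ?thesis
    by (simp add: opinions_def)
qed

lemma solution_opinions: "op_solution E w b x \<Longrightarrow> x k \<in> opinions"
  by (induction k) (auto simp: op_solution_def F_opinions)

lemma solution_mirror:
  assumes "op_solution E w b x"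
  shows "op_solution E w b (\<lambda>k. mirror (x k))"
  using assms solution_opinions[OF assms]
  by (simp add: op_solution_def defined_mirror F_mirror)

lemma equilibrium_mirror:
  "op_equilibrium E w b p \<Longrightarrow> op_equilibrium E w b (mirror p)"
  by (simp add: op_equilibrium_def defined_mirror F_mirror)

lemma stable_mirror:
  assumes "op_stable E w b p"
  shows "op_stable E w b (mirror p)"
  unfolding op_stable_def
proof (intro allI impI)
  fix \<epsilon> :: real
  assume "0 < \<epsilon>"
  then obtain \<delta> where "0 < \<delta>"
    and \<delta>: "\<And>x k. op_solution E w b x \<Longrightarrow> dist (x 0) p < \<delta> \<Longrightarrow> dist (x k) p < \<epsilon>"
    using assms unfolding op_stable_def by meson
  have "dist (x k) (mirror p) < \<epsilon>"
    if "op_solution E w b x" "dist (x 0) (mirror p) < \<delta>" for x k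
    using \<delta>[OF solution_mirror[OF that(1)], of k] that(2) by (metis dist_mirror mirror_mirror)
  then show "\<exists>\<delta>>0. \<forall>x. op_solution E w b x \<and> dist (x 0) (mirror p) < \<delta> \<longrightarrow>
      (\<forall>k. dist (x k) (mirror p) < \<epsilon>)"
    using \<open>0 < \<delta>\<close> by blast
qed

lemma unstable_mirror: "op_unstable E w b (mirror p) \<Longrightarrow> op_unstable E w b p"
  unfolding op_unstable_def using stable_mirror[of p] equilibrium_mirror[of "mirror p"] by auto

lemma exp_stable_mirror:
  assumes "op_exp_stable E w b p"
  shows "op_exp_stable E w b (mirror p)"
proof -
  obtain \<delta> M \<rho> where pos: "0 < \<delta>" "0 < M" "0 < \<rho>" "\<rho> < 1"
    and decay: "\<And>x0. x0 \<in> opinions \<Longrightarrow> dist x0 p < \<delta> \<Longrightarrow>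
       \<exists>x. op_solution E w b x \<and> x 0 = x0 \<and> (\<forall>k. dist (x k) p \<le> M * \<rho> ^ k * dist x0 p)"
    using assms unfolding op_exp_stable_def by metis
  have "\<exists>x. op_solution E w b x \<and> x 0 = x0 \<and>
      (\<forall>k. dist (x k) (mirror p) \<le> M * \<rho> ^ k * dist x0 (mirror p))"
    if x0: "x0 \<in> opinions" "dist x0 (mirror p) < \<delta>" for x0
  proof -
    have d0: "dist (mirror x0) p = dist x0 (mirror p)"
      by (metis dist_mirror mirror_mirror)
    then obtain x where "op_solution E w b x" "x 0 = mirror x0"
      "\<forall>k. dist (x k) p \<le> M * \<rho> ^ k * dist x0 (mirror p)"
      using decay[of "mirror x0"] x0 by auto
    then show ?thesis
      by (intro exI[of _ "\<lambda>k. mirror (x k)"]) (simp add: solution_mirror)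
  qed
  then show ?thesis
    using assms pos unfolding op_exp_stable_def by (metis equilibrium_mirror)
qed

section \<open>Exponential stability of the consensus states\<close>

text \<open>
  On the cube $[0, 1/8]^N$ we have $s_i \le d_i / 8$, and the denominator is at least
  $w_{ii} + (7/8)^2 d_i$; hence $f_i(x) \le \rho_i x_i$ with
  $\rho_i = (w_{ii} + d_i / 8) / (w_{ii} + 3 d_i / 4) < 1$. The side length $1/8$ is an arbitrary
  choice that leaves room between the two constants.
\<close>

lemma contraction_near_zero:
  assumes "x \<in> opinions" "\<And>j. x $ j \<le> 1/8"
  shows "0 < den x i"
    and "F x $ i \<le> (w $ i $ i + d i / 8) / (w $ i $ i + 3 * d i / 4) * x $ i"
proof -
  have x: "0 \<le> x $ j" "x $ j \<le> 1/8" for j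
    using assms by (auto simp: opinions_def)
  have "s x i \<le> (\<Sum>j\<in>neighbors E i. w $ i $ j * (1/8))"
    unfolding nbr_sum_def by (intro sum_mono mult_left_mono x weight_nonneg)
  also have "\<dots> = d i / 8"
    by (simp add: nbr_degree_def sum_divide_distrib)
  finally have s: "s x i \<le> d i / 8" .
  have s0: "0 \<le> s x i" and w0: "0 \<le> w $ i $ i" and d0: "0 < d i"
    using s_nonneg[OF assms(1)] weight_nonneg degree_pos by auto
  have "(7/8) * (7/8 * d i) \<le> (1 - x $ i) * (d i - s x i)"
    using x[of i] s d0 by (intro mult_mono) auto
  moreover have "0 \<le> x $ i * s x i"
    using x s0 by simp
  ultimately have den: "w $ i $ i + 3 * d i / 4 \<le> den x i"
    using d0 by (simp add: den_eq[OF assms(1)])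
  have pos: "0 < w $ i $ i + 3 * d i / 4"
    using w0 d0 by simp
  then show "0 < den x i"
    using den by simp
  have "F x $ i = x $ i * (w $ i $ i + s x i) / den x i"
    by (rule F_nth[OF assms(1)])
  also have "\<dots> \<le> x $ i * (w $ i $ i + d i / 8) / (w $ i $ i + 3 * d i / 4)"
    using x w0 d0 s den pos by (intro frac_le mult_left_mono mult_nonneg_nonneg) auto
  finally show "F x $ i \<le> (w $ i $ i + d i / 8) / (w $ i $ i + 3 * d i / 4) * x $ i"
    by (simp add: mult.commute)
qed

lemma exp_stable_zero: "op_exp_stable E w b (\<chi> i. 0)"
proof -
  define r where "r i = (w $ i $ i + d i / 8) / (w $ i $ i + 3 * d i / 4)" for i
  define \<rho> where "\<rho> = Max (range r)"
  have r: "0 < r i" "r i < 1" for i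
    using weight_nonneg[of i i] degree_pos[of i]
    by (auto simp: r_def intro!: divide_pos_pos add_nonneg_pos)
  have r_le: "r i \<le> \<rho>" for i
    unfolding \<rho>_def by (intro Max_ge) auto
  have \<rho>: "0 < \<rho>" "\<rho> < 1"
    using r(1) r_le less_le_trans apply blast
    unfolding \<rho>_def using r(2) by (subst Max_less_iff) auto
  have zero: "(\<chi> i. 0) = (0 :: real^'n)"
    by (simp add: vec_eq_iff)
  have "op_defined E w b 0"
    using contraction_near_zero(1)[of 0]
    by (auto simp: op_defined_def opinions_def less_imp_neq[symmetric])
  then have eq: "op_equilibrium E w b 0"
    by (intro equilibriumI) (auto simp: opinions_def)
  have "\<exists>x. op_solution E w b x \<and> x 0 = x0 \<and> (\<forall>k. dist (x k) 0 \<le> 1 * \<rho> ^ k * dist x0 0)"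
    if x0: "x0 \<in> opinions" "dist x0 0 < 1/8" for x0
  proof -
    define x where "x k = (F ^^ k) x0" for k
    have x0i: "0 \<le> x0 $ i" "x0 $ i \<le> 1/8" for i
      using x0 component_le_norm_cart[of x0 i] by (auto simp: opinions_def)
    have geom: "\<rho> ^ k * x0 $ i \<le> 1/8" for k i
    proof -
      have "\<rho> ^ k * x0 $ i \<le> 1 * x0 $ i"
        using x0i \<rho> by (intro mult_right_mono power_le_one) auto
      then show ?thesis
        using x0i(2)[of i] by simp
    qed
    have inv: "x k \<in> opinions \<and> (\<forall>i. x k $ i \<le> \<rho> ^ k * x0 $ i)" for k
    proof (induction k)
      case 0
      then show ?case
        using x0 by (simp add: x_def)
    next
      case (Suc k)
      then have small: "x k $ i \<le> 1/8" for i
        using geom[of k i] order_trans by blast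
      have "F (x k) $ i \<le> \<rho> ^ Suc k * x0 $ i" for i
      proof -
        have "F (x k) $ i \<le> r i * x k $ i"
          using contraction_near_zero(2)[of "x k" i] Suc small by (simp add: r_def)
        also have "\<dots> \<le> \<rho> * (\<rho> ^ k * x0 $ i)"
          using Suc r_le[of i] \<rho> x0i[of i] by (intro mult_mono) (auto simp: opinions_def)
        finally show ?thesis
          by simp
      qed
      then show ?case
        using Suc F_opinions by (simp add: x_def)
    qed
    have small: "x k $ i \<le> 1/8" for k i
      using inv[of k] geom[of k i] order_trans by blast
    have "op_defined E w b (x k)" for k
      using contraction_near_zero(1)[of "x k"] inv[of k] small
      by (auto simp: op_defined_def less_imp_neq[symmetric])
    then have "op_solution E w b x"
      using x0 by (simp add: op_solution_def x_def)
    moreover have "dist (x k) 0 \<le> 1 * \<rho> ^ k * dist x0 0" for k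
    proof -
      have "norm (x k) \<le> norm (\<rho> ^ k *\<^sub>R x0)"
        using inv[of k] x0i \<rho> by (intro norm_le_componentwise_cart) (auto simp: opinions_def)
      then show ?thesis
        using \<rho> by simp
    qed
    ultimately show ?thesis
      by (intro exI[of _ x]) (simp add: x_def)
  qed
  moreover have "(0::real) < 1/8" "(0::real) < 1"
    by auto
  ultimately show ?thesis
    unfolding zero op_exp_stable_def using eq \<rho> by blast
qed

lemma exp_stable_one: "op_exp_stable E w b (\<chi> i. 1)"
proof -
  have "mirror (\<chi> i. 0) = ((\<chi> i. 1) :: real^'n)"
    by (simp add: vec_eq_iff)
  then show ?thesis
    using exp_stable_mirror[OF exp_stable_zero] by metis
qed

section \<open>Instability by steady drift of one coordinate\<close>

lemma den_pos_open_cube: "x \<in> open_cube \<Longrightarrow> 0 < den x i"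
  by (intro den_pos open_cube_opinions s_pos s_less_degree)

lemma F_open_cube:
  assumes "x \<in> open_cube"
  shows "F x \<in> open_cube"
proof -
  have "0 < F x $ i \<and> F x $ i < 1" for i
  proof -
    let ?A = "x $ i * (w $ i $ i + s x i)" and ?B = "(1 - x $ i) * (w $ i $ i + (d i - s x i))"
    have "0 < ?A" "0 < ?B"
      using assms s_pos[OF assms, of i] s_less_degree[OF assms, of i] weight_nonneg[of i i]
      by (auto simp: open_cube_def intro!: mult_pos_pos add_nonneg_pos)
    then show ?thesis
      using open_cube_opinions[OF assms] by (simp add: F_nth den_split divide_less_eq_1)
  qed
  then show ?thesis
    by (simp add: open_cube_def)
qed

text \<open>
  Interior starting points are used because from them a solution exists even if self-weights
  vanish. The point \<open>q\<close> selects the direction in which the equilibrium is left.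
\<close>

lemma unstableI:
  assumes eq: "op_equilibrium E w b p" and q: "q \<in> open_cube" and "0 < \<epsilon>"
    and leaves: "\<And>x t. \<lbrakk>0 < t; t < 1; x 0 = (1 - t) *\<^sub>R p + t *\<^sub>R q; \<And>k. x k \<in> open_cube;
        \<And>k. x (Suc k) = F (x k); \<And>k. dist (x k) p < \<epsilon>\<rbrakk> \<Longrightarrow> False"
  shows "op_unstable E w b p"
proof -
  have p: "p \<in> opinions"
    using eq by (simp add: op_equilibrium_def)
  have False if stable: "op_stable E w b p"
  proof -
    obtain \<delta> where "0 < \<delta>"
      and \<delta>: "\<And>x k. op_solution E w b x \<Longrightarrow> dist (x 0) p < \<delta> \<Longrightarrow> dist (x k) p < \<epsilon>"
      using stable[unfolded op_stable_def, rule_format, OF \<open>0 < \<epsilon>\<close>] by blast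
    define t where "t = min (1/2) (\<delta> / (2 * (1 + dist q p)))"
    have pos: "0 < 1 + dist q p"
      by (simp add: add_pos_nonneg)
    then have t: "0 < t" "t < 1"
      using \<open>0 < \<delta>\<close> by (auto simp: t_def)
    define x where "x k = (F ^^ k) ((1 - t) *\<^sub>R p + t *\<^sub>R q)" for k
    have cube: "x k \<in> open_cube" for k
      by (induction k) (use p q t in \<open>auto simp: x_def convex_comb_open_cube F_open_cube\<close>)
    have "op_defined E w b (x k)" for k
      unfolding op_defined_def using den_pos_open_cube[OF cube] by (metis less_irrefl)
    moreover have "x 0 \<in> opinions"
      by (rule open_cube_opinions[OF cube])
    moreover have "x (Suc k) = F (x k)" for k
      by (simp add: x_def)
    ultimately have sol: "op_solution E w b x"
      unfolding op_solution_def by blast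
    have "x 0 - p = t *\<^sub>R (q - p)"
      by (simp add: x_def algebra_simps)
    then have "dist (x 0) p = t * dist q p"
      using t by (simp add: dist_norm)
    also have "\<dots> \<le> \<delta> / (2 * (1 + dist q p)) * (1 + dist q p)"
      using t pos \<open>0 < \<delta>\<close> by (intro mult_mono) (auto simp: t_def)
    also have "\<dots> = \<delta> / 2"
      using pos by (simp add: field_simps)
    finally have "dist (x 0) p < \<delta>"
      using \<open>0 < \<delta>\<close> by simp
    then have "dist (x k) p < \<epsilon>" for k
      using \<delta>[OF sol] by blast
    then show False
      using leaves[of t x] t cube by (simp add: x_def)
  qed
  then show ?thesis
    using eq by (auto simp: op_unstable_def)
qed

lemma continuous_s: "continuous_on UNIV (\<lambda>x. s x i)"
  unfolding nbr_sum_def by (intro continuous_intros)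

text \<open>
  As long as the neighbors lean to $0$, the distance $1 - x_i$ cannot shrink, and it
  grows in each step by at least a fixed fraction of its (positive) initial value.
\<close>

lemma unstable_if_one_against_neighbors:
  assumes eq: "op_equilibrium E w b p" and one: "p $ i = 1" and lean: "2 * s p i < d i"
  shows "op_unstable E w b p"
proof -
  \<comment> \<open>While \<open>s x i\<close> is within \<open>\<kappa>\<close> of \<open>s p i\<close>, half of the lean \<open>4 * \<kappa>\<close> survives.\<close>
  define \<kappa> where "\<kappa> = (d i - 2 * s p i) / 4"
  have \<kappa>: "0 < \<kappa>"
    using lean by (simp add: \<kappa>_def)
  obtain \<delta> where \<delta>: "0 < \<delta>" "\<And>x. dist x p < \<delta> \<Longrightarrow> dist (s x i) (s p i) < \<kappa>"
    using continuous_s[of i, unfolded continuous_on_iff] \<kappa> by fastforce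
  define q :: "real^'n" where "q = (\<chi> j. 1/2)"
  define C where "C = w $ i $ i + d i"
  have C: "0 < C"
    unfolding C_def by (intro add_nonneg_pos weight_nonneg degree_pos)
  show ?thesis
  proof (rule unstableI[OF eq, of q "min \<delta> (1/2)"])
    show "q \<in> open_cube"
      by (simp add: q_def open_cube_def)
    show "0 < min \<delta> (1/2)"
      using \<delta> by simp
    fix x t
    assume cube: "\<And>k. x k \<in> open_cube" and step: "\<And>k. x (Suc k) = F (x k)"
      and near: "\<And>k. dist (x k) p < min \<delta> (1/2)"
    define u where "u k = 1 - x k $ i" for k
    have u: "0 < u k" "u k < 1" for k
      using cube[of k] by (auto simp: u_def open_cube_def)
    have rate: "u k * (\<kappa> / C) \<le> u (Suc k) - u k" for k
    proof -
      have "dist (x k $ i) (p $ i) < 1/2"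
        using near[of k] dist_vec_nth_le[of "x k" i p] by simp
      then have xi: "1/2 \<le> x k $ i"
        using one unfolding dist_real_def by linarith
      have "dist (s (x k) i) (s p i) < \<kappa>"
        using near[of k] \<delta>(2) by simp
      moreover have "4 * \<kappa> = d i - 2 * s p i"
        by (simp add: \<kappa>_def)
      ultimately have lean_k: "2 * \<kappa> \<le> d i - 2 * s (x k) i"
        unfolding dist_real_def by linarith
      have den: "0 < den (x k) i" "den (x k) i \<le> C"
        using den_pos_open_cube[OF cube] den_le[OF open_cube_opinions[OF cube]] by (auto simp: C_def)
      have neg: "u k * (x k $ i * (d i - 2 * s (x k) i))
          = - (x k $ i * (1 - x k $ i) * (2 * s (x k) i - d i))"
        by (simp add: u_def algebra_simps)
      have "u k * (\<kappa> / C) = u k * (1/2 * (2 * \<kappa>)) / C"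
        by simp
      also have "\<dots> \<le> u k * (x k $ i * (d i - 2 * s (x k) i)) / den (x k) i"
        using u[of k] xi lean_k den \<kappa> by (intro frac_le mult_left_mono mult_mono mult_nonneg_nonneg) auto
      also have "\<dots> = - (x k $ i * (1 - x k $ i) * (2 * s (x k) i - d i) / den (x k) i)"
        by (subst neg) (rule minus_divide_left[symmetric])
      also have "\<dots> = u (Suc k) - u k"
        using increment[OF open_cube_opinions[OF cube], of k i] den(1) step[of k]
        by (simp add: u_def)
      finally show ?thesis .
    qed
    have incr: "u k \<le> u (Suc k)" for k
      using rate[of k] u[of k] \<kappa> C by (smt (verit) divide_pos_pos mult_pos_pos)
    have "u 0 * (\<kappa> / C) \<le> u k * (\<kappa> / C)" for k
      using lift_Suc_mono_le[of u 0 k] incr \<kappa> C by (intro mult_right_mono) auto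
    then have growth: "u k + u 0 * (\<kappa> / C) \<le> u (Suc k)" for k
      using rate[of k] by (smt (verit))
    show False
      by (rule no_bounded_steady_growth[where u = u and B = 1, OF _ growth])
        (use u \<kappa> C in \<open>auto simp: less_imp_le\<close>)
  qed
qed

corollary unstable_if_zero_against_neighbors:
  assumes "op_equilibrium E w b p" "p $ i = 0" "d i < 2 * s p i"
  shows "op_unstable E w b p"
  by (rule unstable_mirror, rule unstable_if_one_against_neighbors[where i = i])
    (use assms in \<open>simp_all add: equilibrium_mirror s_mirror\<close>)

text \<open>
  A start slightly off the equilibrium, in the direction of a vector with all entries above $1/2$,
  breaks the balance of the neighbors in favor of $1$. This pushes the hub up; the hub is above
  $1/2$ and the only one its neighbors listen to, so they move up as well, and the lean of the
  neighbors towards $1$ never falls below its initial value.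
\<close>

lemma unstable_if_balanced_upper_hub:
  assumes eq: "op_equilibrium E w b p"
    and nb: "\<And>j. j \<in> neighbors E v \<Longrightarrow> neighbors E j = {v}"
    and hub: "1/2 \<le> p $ v" "p $ v < 1" and bal: "2 * s p v = d v"
  shows "op_unstable E w b p"
proof -
  define q :: "real^'n" where "q = (\<chi> j. 3/4)"
  define m where "m = (1 - p $ v) / 2"
  have m: "0 < m"
    using hub by (simp add: m_def)
  define C where "C = w $ v $ v + d v"
  have C: "0 < C"
    unfolding C_def by (intro add_nonneg_pos weight_nonneg degree_pos)
  show ?thesis
  proof (rule unstableI[OF eq, of q m])
    show "q \<in> open_cube"
      by (simp add: q_def open_cube_def)
    show "0 < m" by (rule m)
    fix x t
    assume t: "0 < t" "t < 1" and x0: "x 0 = (1 - t) *\<^sub>R p + t *\<^sub>R q"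
      and cube: "\<And>k. x k \<in> open_cube" and step: "\<And>k. x (Suc k) = F (x k)"
      and near: "\<And>k. dist (x k) p < m"
    have xb: "0 < x k $ i" "x k $ i < 1" for k i
      using cube[of k] by (auto simp: open_cube_def)
    have incr: "x (Suc k) $ i - x k $ i
        = x k $ i * (1 - x k $ i) * (2 * s (x k) i - d i) / den (x k) i" for k i
      using increment[OF open_cube_opinions[OF cube], of k i] den_pos_open_cube[OF cube, of k i]
      by (simp add: step)
    have up: "x k $ i \<le> x (Suc k) $ i" if "d i \<le> 2 * s (x k) i" for k i
    proof -
      have "0 \<le> x (Suc k) $ i - x k $ i"
        unfolding incr using that xb[of k i] den_pos_open_cube[OF cube, of k i]
        by (intro divide_nonneg_pos mult_nonneg_nonneg) auto
      then show ?thesis by simp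
    qed
    define g where "g = 2 * s (x 0) v - d v"
    have "s (x 0) v = (1 - t) * s p v + t * (3/4 * d v)"
      by (simp add: x0 q_def nbr_sum_def nbr_degree_def algebra_simps sum.distrib
          sum_distrib_left sum_subtractf)
    then have "g = t * (d v / 2)"
      by (simp add: g_def bal[symmetric] algebra_simps)
    then have g: "0 < g"
      using t degree_pos[of v] by (metis half_gt_zero mult_pos_pos)
    have inv: "1/2 \<le> x k $ v \<and> d v + g \<le> 2 * s (x k) v" for k
    proof (induction k)
      case 0
      have "(1 - t) * (1/2) + t * (1/2) \<le> (1 - t) * p $ v + t * (3/4)"
        using hub t by (intro add_mono mult_left_mono) auto
      then show ?case
        by (simp add: g_def x0 q_def field_simps)
    next
      case (Suc k)
      have "x k $ j \<le> x (Suc k) $ j" if j: "j \<in> neighbors E v" for j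
      proof (rule up)
        have "w $ j $ v * 1 \<le> w $ j $ v * (2 * x k $ v)"
          using Suc by (intro mult_left_mono weight_nonneg) auto
        then show "d j \<le> 2 * s (x k) j"
          using nb[OF j] by (simp add: nbr_degree_def nbr_sum_def)
      qed
      then have "s (x k) v \<le> s (x (Suc k)) v"
        unfolding nbr_sum_def by (intro sum_mono mult_left_mono weight_nonneg)
      moreover have "x k $ v \<le> x (Suc k) $ v"
        using Suc g by (intro up) simp
      ultimately show ?case
        using Suc by simp
    qed
    have growth: "x k $ v + (1/2 * m) * g / C \<le> x (Suc k) $ v" for k
    proof -
      have "dist (x k $ v) (p $ v) < m"
        using near[of k] dist_vec_nth_le[of "x k" v p] by simp
      moreover have "2 * m = 1 - p $ v"
        by (simp add: m_def)
      ultimately have gap: "m \<le> 1 - x k $ v"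
        unfolding dist_real_def by linarith
      have den: "0 < den (x k) v" "den (x k) v \<le> C"
        using den_pos_open_cube[OF cube] den_le[OF open_cube_opinions[OF cube]] by (auto simp: C_def)
      have "(1/2 * m) * g / C
          \<le> (x k $ v * (1 - x k $ v)) * (2 * s (x k) v - d v) / den (x k) v"
        using inv[of k] gap m g den xb[of k v] by (intro frac_le mult_mono mult_nonneg_nonneg) auto
      then show ?thesis
        using incr[of k v] by simp
    qed
    show False
      by (rule no_bounded_steady_growth[where u = "\<lambda>k. x k $ v" and B = 1, OF _ growth])
        (use xb m g C in \<open>auto simp: less_imp_le\<close>)
  qed
qed

lemma unstable_if_balanced_hub:
  assumes "op_equilibrium E w b p" "\<And>j. j \<in> neighbors E v \<Longrightarrow> neighbors E j = {v}"
    and "0 < p $ v" "p $ v < 1" "2 * s p v = d v"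
  shows "op_unstable E w b p"
proof (cases "1/2 \<le> p $ v")
  case True
  then show ?thesis
    using unstable_if_balanced_upper_hub assms by blast
next
  case False
  then have "op_unstable E w b (mirror p)"
  proof (intro unstable_if_balanced_upper_hub)
    show "2 * s (mirror p) v = d v"
      using assms(5) by (simp add: s_mirror algebra_simps)
  qed (use assms False in \<open>simp_all add: equilibrium_mirror\<close>)
  then show ?thesis
    by (rule unstable_mirror)
qed

end

section \<open>The star graph\<close>

lemma split_states_leaf_sum:
  fixes x :: "real^'n::finite"
  assumes "x \<in> split_states v" "odd CARD('n)"
  shows "(\<Sum>i\<in>UNIV - {v}. x $ i) = (real CARD('n) - 1) / 2"
proof -
  obtain Z where Z: "v \<notin> Z" "card Z = (CARD('n) - 1) div 2"
    and x: "\<And>i. i \<noteq> v \<Longrightarrow> x $ i = (if i \<in> Z then 0 else 1)"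
    using assms(1) by (auto simp: split_states_def)
  have "(\<Sum>i\<in>UNIV - {v}. x $ i) = (\<Sum>i\<in>UNIV - {v}. if i \<in> Z then 0 else 1)"
    by (intro sum.cong) (auto simp: x)
  also have "\<dots> = real (card (UNIV - {v} - Z))"
    by (simp add: sum.If_cases Int_def set_diff_eq)
  also have "card (UNIV - {v} - Z) = CARD('n) - 1 - (CARD('n) - 1) div 2"
    using Z by (subst card_Diff_subset) auto
  also have "real \<dots> = (real CARD('n) - 1) / 2"
    using assms(2) by (auto elim!: oddE)
  finally show ?thesis .
qed

theorem theorem7:
  fixes w :: "real^'n^'n" and b :: "real^'n" and v :: "'n::finite"
  assumes "CARD('n) \<ge> 2"
    and "\<forall>i. b $ i = 1"
    and "\<forall>i. w $ i $ i \<ge> 0"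
    and "\<forall>i j. i \<noteq> j \<longrightarrow> w $ i $ j = 1"
  shows "(\<forall>x\<in>binary_states. op_defined (star_edges v) w b x \<longrightarrow> op_equilibrium (star_edges v) w b x)
    \<and> (\<forall>x\<in>half_states v. op_equilibrium (star_edges v) w b x)
    \<and> (odd CARD('n) \<longrightarrow> (\<forall>x\<in>split_states v. op_equilibrium (star_edges v) w b x))
    \<and> op_exp_stable (star_edges v) w b (\<chi> i. 0)
    \<and> op_exp_stable (star_edges v) w b (\<chi> i. 1)
    \<and> (\<forall>x. (x \<in> binary_states \<and> op_defined (star_edges v) w b x
              \<or> x \<in> half_states v
              \<or> odd CARD('n) \<and> x \<in> split_states v)
          \<and> x \<noteq> (\<chi> i. 0) \<and> x \<noteq> (\<chi> i. 1)
          \<longrightarrow> op_unstable (star_edges v) w b x)"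
proof -
  let ?E = "star_edges v"
  have deg_center: "nbr_degree ?E w v = real CARD('n) - 1"
    using assms(1,4) by (simp add: nbr_degree_def neighbors_star card_Diff_singleton of_nat_diff)
  have deg_leaf: "nbr_degree ?E w i = 1" if "i \<noteq> v" for i
    using assms(4) that by (simp add: nbr_degree_def neighbors_star)
  have sum_center: "nbr_sum ?E w x v = (\<Sum>i\<in>UNIV - {v}. x $ i)" for x
    using assms(4) by (auto simp: nbr_sum_def neighbors_star intro: sum.cong)
  have sum_leaf: "nbr_sum ?E w x i = x $ v" if "i \<noteq> v" for i x
    using assms(4) that by (simp add: nbr_sum_def neighbors_star)
  interpret unit_bias ?E w b
  proof
    fix i j
    show "b $ i = 1"
      using assms(2) by simp
    show "0 \<le> w $ i $ j"
      using assms(3,4) by (cases "i = j") auto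
    show "0 < nbr_degree ?E w i"
      using assms(1) deg_center deg_leaf by (cases "i = v") auto
  qed
  have binary: "op_equilibrium ?E w b x" if "x \<in> binary_states" "op_defined ?E w b x" for x
  proof (rule equilibriumI)
    have "0 \<le> x $ i \<and> x $ i \<le> 1" for i
      using that(1) by (cases "x $ i = 0") (auto simp: binary_states_def)
    then show "x \<in> opinions"
      by (simp add: opinions_def)
    show "x $ i = 0 \<or> x $ i = 1 \<or> 2 * nbr_sum ?E w x i = nbr_degree ?E w i" for i
      using that(1) by (auto simp: binary_states_def)
  qed (rule that(2))
  \<comment> \<open>Half states and split states have in common what matters: a center strictly inside, leaves that
    balance each other, and each leaf at an end point or facing a center at \<open>1/2\<close>.\<close>
  have balanced: "op_equilibrium ?E w b x \<and> op_unstable ?E w b x"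
    if "x \<in> opinions" "0 < x $ v" "x $ v < 1"
      and leaf_sum: "(\<Sum>i\<in>UNIV - {v}. x $ i) = (real CARD('n) - 1) / 2"
      and leaf: "\<And>i. i \<noteq> v \<Longrightarrow> x $ i = 0 \<or> x $ i = 1 \<or> x $ v = 1/2" for x
  proof -
    have bal: "2 * nbr_sum ?E w x v = nbr_degree ?E w v"
      by (simp add: sum_center leaf_sum deg_center)
    have "0 < nbr_sum ?E w x i \<and> nbr_sum ?E w x i < nbr_degree ?E w i" for i
      using that(2,3) bal degree_pos[of v] by (cases "i = v") (auto simp: sum_leaf deg_leaf)
    then have "op_defined ?E w b x"
      using den_pos[OF that(1)] unfolding op_defined_def by (metis less_irrefl)
    moreover have "x $ i = 0 \<or> x $ i = 1 \<or> 2 * nbr_sum ?E w x i = nbr_degree ?E w i" for i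
      using leaf[of i] bal by (cases "i = v") (auto simp: sum_leaf deg_leaf)
    ultimately have eq: "op_equilibrium ?E w b x"
      using that(1) equilibriumI by blast
    moreover have "op_unstable ?E w b x"
      using eq _ that(2,3) bal
      by (rule unstable_if_balanced_hub) (auto simp: neighbors_star split: if_splits)
    ultimately show ?thesis ..
  qed
  have half: "op_equilibrium ?E w b x \<and> op_unstable ?E w b x" if "x \<in> half_states v" for x
  proof (rule balanced)
    have "0 \<le> x $ i \<and> x $ i \<le> 1" for i
      using that by (cases "i = v") (auto simp: half_states_def)
    then show "x \<in> opinions"
      by (simp add: opinions_def)
  qed (use that in \<open>auto simp: half_states_def\<close>)
  have split: "op_equilibrium ?E w b x \<and> op_unstable ?E w b x"
    if "x \<in> split_states v" "odd CARD('n)" for x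
  proof (rule balanced)
    obtain Z where Z: "\<And>i. i \<noteq> v \<Longrightarrow> x $ i = (if i \<in> Z then 0 else 1)"
      using \<open>x \<in> split_states v\<close> by (auto simp: split_states_def)
    have ends: "x $ i = 0 \<or> x $ i = 1" if "i \<noteq> v" for i
      using Z[OF that] by (cases "i \<in> Z") simp_all
    then show "x $ i = 0 \<or> x $ i = 1 \<or> x $ v = 1/2" if "i \<noteq> v" for i
      using that by blast
    show center: "0 < x $ v" "x $ v < 1"
      using that(1) by (auto simp: split_states_def)
    have "0 \<le> x $ i \<and> x $ i \<le> 1" for i
      using ends[of i] center by (cases "i = v") auto
    then show "x \<in> opinions"
      by (simp add: opinions_def)
  qed (rule split_states_leaf_sum[OF that])
  have binary_unstable: "op_unstable ?E w b x"
    if x: "x \<in> binary_states" "op_defined ?E w b x" "x \<noteq> (\<chi> i. 0)" "x \<noteq> (\<chi> i. 1)" for x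
  proof -
    have bin: "x $ i = 0 \<or> x $ i = 1" for i
      using x(1) by (simp add: binary_states_def)
    show ?thesis
    proof (cases "x $ v = 0")
      case True
      obtain i where "x $ i \<noteq> 0"
        using x(3) by (auto simp: vec_eq_iff)
      then have "i \<noteq> v" "x $ i = 1"
        using True bin by auto
      then show ?thesis
        using unstable_if_one_against_neighbors[OF binary[OF x(1,2)], of i] True
        by (simp add: sum_leaf deg_leaf)
    next
      case False
      then have one: "x $ v = 1"
        using bin by blast
      obtain i where "x $ i \<noteq> 1"
        using x(4) by (auto simp: vec_eq_iff)
      then have "i \<noteq> v" "x $ i = 0"
        using one bin by auto
      then show ?thesis
        using unstable_if_zero_against_neighbors[OF binary[OF x(1,2)], of i] one
        by (simp add: sum_leaf deg_leaf)
    qed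
  qed
  show ?thesis
    using binary half split binary_unstable exp_stable_zero exp_stable_one by blast
qed

end
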